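(* Let $\mathcal{G}=\{G_1,G_2,\ldots,G_k\}$, $k\ge 2$, be a family of connected graphs on a common vertex set $V$ with $|V|\ge 3$. For each $u\in V$ let $m_{\mathcal{G}}(u)$ be the number of indices $i\in\{1,\ldots,k\}$ such that $u$ belongs to a nontrivial twin equivalence class of $G_i$. If $m_{\mathcal{G}}$ is a positive constant function on $V$, then $\mathrm{Sd}_f(\mathcal{G})=\frac{|V|}{2}$.
   Context: Graphs are finite, simple and undirected. $d_G(x,y)$ is the least number of edges on a path joining $x$ and $y$ in $G$ ($\infty$ if there is none). For distinct $x,y\in V(G)$, $R_G\{x,y\}=\{z\in V(G): d_G(x,z)\ne d_G(y,z)\}$. For a function $g$ on $V$ and $U\subseteq V$, $g(U)=\sum_{s\in U}g(s)$. A resolving function of $G$ is a function $g:V(G)\to[0,1]$ with $g(R_G\{x,y\})\ge 1$ for all distinct $x,y\in V(G)$. For a family $\mathcal{G}$ of graphs on a common vertex set $V$, a simultaneous resolving function is a function $g:V\to[0,1]$ that is a resolving function of every member of $\mathcal{G}$, and the simultaneous fractional dimension $\mathrm{Sd}_f(\mathcal{G})$ is the minimum of $g(V)$ over all simultaneous resolving functions $g$ of $\mathcal{G}$. With $N_G(v)$ the open neighborhood of $v$, two vertices $u,w$ of $G$ are twins if $N_G(u)-\{w\}=N_G(w)-\{u\}$ (every vertex is its own twin); this is an equivalence relation, and its classes are the twin equivalence classes of $G$. A twin equivalence class is nontrivial if it contains at least two vertices. *)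

theory Defs
  imports "HOL-Analysis.Analysis" "HOL-Library.Extended_Nat" "Graph_Theory.Graph_Theory"
begin

text \<open>
  A finite simple undirected graph is a \<open>pair_graph\<close>: a finite, loop-free, symmetric set of arcs
  given as ordered pairs. An edge is represented by its two opposite arcs, and a path uses
  exactly one of them, so the length of an arc path is its number of edges.
\<close>

text \<open>The infimum of the empty set of extended naturals is \<open>\<infinity>\<close>.\<close>

definition gdist :: "'a pair_pre_digraph \<Rightarrow> 'a \<Rightarrow> 'a \<Rightarrow> enat" where
  "gdist G x y = (INF p \<in> {p. pre_digraph.apath (with_proj G) x p y}. enat (length p))"

definition resolving_set :: "'a pair_pre_digraph \<Rightarrow> 'a \<Rightarrow> 'a \<Rightarrow> 'a set" where
  "resolving_set G x y = {z \<in> pverts G. gdist G x z \<noteq> gdist G y z}"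

text \<open>
  Functions on the vertex set are total functions whose values outside the vertex set
  are irrelevant.
\<close>

definition resolving_function :: "'a pair_pre_digraph \<Rightarrow> ('a \<Rightarrow> real) \<Rightarrow> bool" where
  "resolving_function G g \<longleftrightarrow>
     g \<in> pverts G \<rightarrow> {0..1} \<and>
     (\<forall>x \<in> pverts G. \<forall>y \<in> pverts G. x \<noteq> y \<longrightarrow> sum g (resolving_set G x y) \<ge> 1)"

definition simultaneous_resolving_function ::
    "'a set \<Rightarrow> 'a pair_pre_digraph set \<Rightarrow> ('a \<Rightarrow> real) \<Rightarrow> bool" where
  "simultaneous_resolving_function V \<G> g \<longleftrightarrow>
     g \<in> V \<rightarrow> {0..1} \<and> (\<forall>G \<in> \<G>. resolving_function G g)"

text \<open>The minimum exists; see \<open>Sd_f_attained\<close> below.\<close>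

definition Sd_f :: "'a set \<Rightarrow> 'a pair_pre_digraph set \<Rightarrow> real" where
  "Sd_f V \<G> = (LEAST r. \<exists>g. simultaneous_resolving_function V \<G> g \<and> r = sum g V)"

definition open_neighborhood :: "'a pair_pre_digraph \<Rightarrow> 'a \<Rightarrow> 'a set" where
  "open_neighborhood G v = {w \<in> pverts G. (v, w) \<in> parcs G}"

definition twin_rel :: "'a pair_pre_digraph \<Rightarrow> 'a rel" where
  "twin_rel G = {(u, w). u \<in> pverts G \<and> w \<in> pverts G \<and>
     open_neighborhood G u - {w} = open_neighborhood G w - {u}}"

definition twin_classes :: "'a pair_pre_digraph \<Rightarrow> 'a set set" where
  "twin_classes G = pverts G // twin_rel G"

definition nontrivial_twin_classes :: "'a pair_pre_digraph \<Rightarrow> 'a set set" where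
  "nontrivial_twin_classes G = {C \<in> twin_classes G. card C \<ge> 2}"

definition twin_count :: "nat \<Rightarrow> (nat \<Rightarrow> 'a pair_pre_digraph) \<Rightarrow> 'a \<Rightarrow> nat" where
  "twin_count k G u = card {i \<in> {1..k}. \<exists>C \<in> nontrivial_twin_classes (G i). u \<in> C}"

lemma equiv_twin_rel:
  assumes "pair_graph G"
  shows "equiv (pverts G) (twin_rel G)"
proof -
  interpret pair_graph G by fact
  have s: "(v, w) \<in> parcs G \<longleftrightarrow> (w, v) \<in> parcs G" for v w
    using pair_sym_arcs by (auto simp: symmetric_def dest: symD)
  have irr: "(v, v) \<notin> parcs G" for v
    using pair_no_loops by fastforce
  have tw: "(u, w) \<in> twin_rel G \<longleftrightarrow> u \<in> pverts G \<and> w \<in> pverts G \<and>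
      (\<forall>z. z \<noteq> u \<longrightarrow> z \<noteq> w \<longrightarrow> ((u, z) \<in> parcs G \<longleftrightarrow> (w, z) \<in> parcs G))" for u w
  proof -
    have "(open_neighborhood G u - {w} = open_neighborhood G w - {u}) \<longleftrightarrow>
        (\<forall>z. (u, z) \<in> parcs G \<and> z \<noteq> w \<longleftrightarrow> (w, z) \<in> parcs G \<and> z \<noteq> u)"
      by (auto simp: open_neighborhood_def set_eq_iff dest: in_arcsD2)
    also have "\<dots> \<longleftrightarrow>
        (\<forall>z. z \<noteq> u \<longrightarrow> z \<noteq> w \<longrightarrow> ((u, z) \<in> parcs G \<longleftrightarrow> (w, z) \<in> parcs G))"
      using irr[of u] irr[of w] by (intro iff_allI) auto
    finally show ?thesis by (simp add: twin_rel_def)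
  qed
  have "(u, x) \<in> twin_rel G" if uw: "(u, w) \<in> twin_rel G" and wx: "(w, x) \<in> twin_rel G" for u w x
  proof (cases "u = w \<or> w = x \<or> u = x")
    case True
    then show ?thesis using uw wx by (auto simp: tw)
  next
    case False
    have "((u, z) \<in> parcs G \<longleftrightarrow> (x, z) \<in> parcs G)" if "z \<noteq> u" "z \<noteq> x" for z
    proof (cases "z = w")
      case True
      then show ?thesis using uw wx False by (metis s tw)
    next
      case False
      then show ?thesis using uw wx that by (auto simp: tw)
    qed
    then show ?thesis using uw wx by (auto simp: tw)
  qed
  then have "trans (twin_rel G)"
    by (rule transI)
  moreover have "sym (twin_rel G)"
    by (rule symI) (unfold tw, blast)
  moreover have "refl_on (pverts G) (twin_rel G)"
    by (rule refl_onI) (simp add: tw)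
  moreover have "twin_rel G \<subseteq> pverts G \<times> pverts G"
    by (auto simp: twin_rel_def)
  ultimately show ?thesis
    by (simp add: equiv_def)
qed

lemma Sd_f_attained:
  assumes fin: "finite V"
    and G: "\<And>G. G \<in> \<G> \<Longrightarrow> pair_graph G" "\<And>G. G \<in> \<G> \<Longrightarrow> pverts G = V"
  obtains g where "simultaneous_resolving_function V \<G> g" "sum g V = Sd_f V \<G>"
    "\<And>h. simultaneous_resolving_function V \<G> h \<Longrightarrow> sum g V \<le> sum h V"
proof -
  let ?P = "simultaneous_resolving_function V \<G>"
  define K where "K = (Pi\<^sub>E UNIV (\<lambda>v. if v \<in> V then {0..1} else {0}) :: ('a \<Rightarrow> real) set)"
  define R where "R = {(G, x, y). G \<in> \<G> \<and> x \<in> V \<and> y \<in> V \<and> x \<noteq> y}"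
  define S where "S = K \<inter> (\<Inter>(G, x, y) \<in> R. {g. 1 \<le> sum g (resolving_set G x y)})"
  have cs: "continuous_on UNIV (\<lambda>g :: 'a \<Rightarrow> real. sum g A)" for A
    by (intro continuous_intros) auto
  have K_eq: "K = {g. (\<forall>v \<in> V. 0 \<le> g v \<and> g v \<le> 1) \<and> (\<forall>v. v \<notin> V \<longrightarrow> g v = 0)}"
    by (auto simp: K_def PiE_iff split: if_splits)
  have "compact K"
    unfolding K_def compactin_euclidean_iff[symmetric] euclidean_product_topology[symmetric]
    by (subst compactin_PiE) (simp add: compactin_euclidean_iff)
  moreover have "closed (\<Inter>(G, x, y) \<in> R. {g :: 'a \<Rightarrow> real. 1 \<le> sum g (resolving_set G x y)})"
    by (auto intro!: closed_INT closed_Collect_le continuous_on_const cs)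
  ultimately have cpt: "compact S"
    unfolding S_def by (rule compact_Int_closed)
  have P_iff: "?P g \<longleftrightarrow> (\<forall>v \<in> V. 0 \<le> g v \<and> g v \<le> 1) \<and>
      (\<forall>(G, x, y) \<in> R. 1 \<le> sum g (resolving_set G x y))" for g
  proof -
    have "resolving_function G g \<longleftrightarrow> g \<in> V \<rightarrow> {0..1} \<and>
        (\<forall>x \<in> V. \<forall>y \<in> V. x \<noteq> y \<longrightarrow> 1 \<le> sum g (resolving_set G x y))" if "G \<in> \<G>" for G
      using G(2)[OF that] by (simp add: resolving_function_def)
    then have "?P g \<longleftrightarrow> g \<in> V \<rightarrow> {0..1} \<and>
        (\<forall>G \<in> \<G>. \<forall>x \<in> V. \<forall>y \<in> V. x \<noteq> y \<longrightarrow> 1 \<le> sum g (resolving_set G x y))"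
      by (cases "g \<in> V \<rightarrow> {0..1}") (simp_all add: simultaneous_resolving_function_def)
    moreover have "g \<in> V \<rightarrow> {0..1} \<longleftrightarrow> (\<forall>v \<in> V. 0 \<le> g v \<and> g v \<le> 1)"
      by (simp add: Pi_iff)
    moreover have "(\<forall>(G, x, y) \<in> R. 1 \<le> sum g (resolving_set G x y)) \<longleftrightarrow>
        (\<forall>G \<in> \<G>. \<forall>x \<in> V. \<forall>y \<in> V. x \<noteq> y \<longrightarrow> 1 \<le> sum g (resolving_set G x y))"
      by (auto simp: R_def)
    ultimately show ?thesis
      by (simp only:)
  qed
  have S_P: "?P g" if "g \<in> S" for g
    using that unfolding P_iff S_def K_eq by blast
  have P_S: "(\<lambda>v. if v \<in> V then h v else 0) \<in> S" if h: "?P h" for h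
  proof -
    have "sum (\<lambda>v. if v \<in> V then h v else 0) (resolving_set G x y) = sum h (resolving_set G x y)"
      if "(G, x, y) \<in> R" for G x y
      using that G(2)[of G] by (intro sum.cong) (auto simp: resolving_set_def R_def)
    then show ?thesis
      using h unfolding P_iff S_def K_eq by auto
  qed
  have "(\<lambda>_. 1) \<in> Collect ?P"
  proof -
    have "1 \<le> card (resolving_set G x y)" if "G \<in> \<G>" "x \<in> V" "y \<in> V" "x \<noteq> y" for G x y
    proof -
      interpret pair_graph G using G that by blast
      have "pverts G = V" using G that by blast
      have "apath x [] x"
        using that \<open>pverts G = V\<close> by (simp add: apath_def awalk_def)
      then have "gdist G x x \<le> enat (length ([] :: ('a \<times> 'a) list))"
        unfolding gdist_def by (intro INF_lower) auto
      then have 0: "gdist G x x = 0" by (simp add: zero_enat_def[symmetric])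
      have "p \<noteq> []" if "apath y p x" for p
        using that \<open>x \<noteq> y\<close> by (auto simp: apath_def awalk_def)
      then have "1 \<le> gdist G y x"
        unfolding gdist_def by (intro INF_greatest) (auto simp: one_enat_def Suc_le_eq)
      with 0 have "x \<in> resolving_set G x y"
        using that \<open>pverts G = V\<close> by (auto simp: resolving_set_def)
      moreover have "finite (resolving_set G x y)"
        using fin \<open>pverts G = V\<close> by (simp add: resolving_set_def)
      ultimately show ?thesis by (metis One_nat_def Suc_leI card_gt_0_iff empty_iff)
    qed
    then show ?thesis
      unfolding mem_Collect_eq P_iff by (auto simp: R_def)
  qed
  then have "S \<noteq> {}" using P_S by blast
  then obtain g where g: "g \<in> S" "\<And>h. h \<in> S \<Longrightarrow> sum g V \<le> sum h V"
    using continuous_attains_inf[OF cpt _ continuous_on_subset[OF cs, of S V]] by auto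
  have min: "sum g V \<le> sum h V" if "?P h" for h
    using g(2)[OF P_S[OF that]] by simp
  have "Sd_f V \<G> = sum g V"
    unfolding Sd_f_def by (rule Least_equality) (use S_P[OF g(1)] min in auto)
  then show thesis using that S_P[OF g(1)] min by metis
qed

end

theory Submission
  imports Defs
begin

text \<open>
  The constant function \<open>1/2\<close> resolves every graph, because \<open>x\<close> and \<open>y\<close> themselves lie in the
  resolving set of the pair \<open>x\<close>, \<open>y\<close>; this bounds the dimension above by \<open>|V|/2\<close>.

  For the lower bound, distinct twins have the same distance to every third vertex
  (\<open>gdist_le_of_twin\<close>), so a resolving function \<open>g\<close> satisfies \<open>g x + g y \<ge> 1\<close> for them. Hence
  \<open>g\<close> has mean at least \<open>1/2\<close> on each nontrivial twin class (\<open>sum_excess_nonneg_of_pairs\<close>), and so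
  on the union \<open>T\<^sub>i\<close> of the nontrivial twin classes of \<open>G\<^sub>i\<close>. That the twin count is a positive
  constant means that the sets \<open>T\<^sub>i\<close> cover every vertex equally often, so the mean of \<open>g\<close> over \<open>V\<close>
  is at least \<open>1/2\<close> as well (\<open>sum_nonneg_of_uniform_cover\<close>, applied to \<open>g - 1/2\<close>).
\<close>

text \<open>Cutting the cycles out of a walk does not lengthen it, so walks bound the distance too.\<close>

lemma gdist_le_awalk:
  assumes "pair_graph G" and "pre_digraph.awalk (with_proj G) x p y"
  shows "gdist G x y \<le> enat (length p)"
proof -
  interpret pair_graph G by fact
  have "\<exists>q. apath x q y \<and> length q \<le> length p"
    using assms(2)
  proof (induct rule: awalk_to_apath_induct)
    case (path p)
    then show ?case by (auto simp: apath_def)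
  next
    case (decomp p q r s)
    then have "length (q @ s) \<le> length p"
      by (elim awalk_cyc_decompE) auto
    with decomp show ?case by (meson order_trans)
  qed
  then obtain q where q: "apath x q y" "length q \<le> length p" by blast
  have "gdist G x y \<le> enat (length q)"
    unfolding gdist_def using q(1) by (intro INF_lower) auto
  then show ?thesis using q(2) by (meson enat_ord_simps(1) order_trans)
qed

lemma gdist_self:
  assumes "pair_graph G" and "x \<in> pverts G"
  shows "gdist G x x = 0"
proof -
  interpret pair_graph G by fact
  have "awalk x [] x" using assms(2) by (simp add: awalk_Nil_iff)
  from gdist_le_awalk[OF assms(1) this] show ?thesis
    by (simp add: zero_enat_def[symmetric])
qed

lemma gdist_pos:
  assumes "pair_graph G" and "x \<noteq> y"
  shows "gdist G x y > 0"
proof -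
  interpret pair_graph G by fact
  have "1 \<le> gdist G x y"
    unfolding gdist_def
  proof (rule INF_greatest)
    fix p assume "p \<in> {p. apath x p y}"
    then have "p \<noteq> []" using \<open>x \<noteq> y\<close> by (auto simp: apath_Nil_iff)
    then show "1 \<le> enat (length p)" by (simp add: one_enat_def Suc_le_eq)
  qed
  then show ?thesis by (auto simp: one_eSuc iless_Suc_eq ileI1)
qed

lemma resolving_set_contains_ends:
  assumes "pair_graph G" "x \<in> pverts G" "y \<in> pverts G" "x \<noteq> y"
  shows "{x, y} \<subseteq> resolving_set G x y"
  using assms gdist_self[of G] gdist_pos[of G x y] gdist_pos[of G y x]
  by (auto simp: resolving_set_def)

text \<open>
  Replacing the first vertex \<open>x\<close> of a path by its twin \<open>y\<close> gives a walk, unless the second vertex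
  is \<open>y\<close>, in which case the first arc is simply dropped.
\<close>

lemma gdist_le_of_twin:
  assumes "pair_graph G" and tw: "(x, y) \<in> twin_rel G" and "z \<noteq> x"
  shows "gdist G y z \<le> gdist G x z"
  unfolding gdist_def[of G x z]
proof (rule INF_greatest)
  interpret pair_graph G by fact
  fix p assume "p \<in> {p. apath x p z}"
  then have p: "awalk x p z" by (auto simp: apath_def)
  then obtain w q where pq: "p = (x, w) # q" and arc: "(x, w) \<in> parcs G" and q: "awalk w q z"
    using \<open>z \<noteq> x\<close> by (cases p) (auto simp: awalk_Nil_iff awalk_Cons_iff)
  show "gdist G y z \<le> enat (length p)"
  proof (cases "w = y")
    case True
    then have "gdist G y z \<le> enat (length q)"
      using gdist_le_awalk[OF assms(1)] q by blast
    also have "\<dots> \<le> enat (length p)" by (simp add: pq)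
    finally show ?thesis .
  next
    case False
    have "w \<in> open_neighborhood G x - {y}"
      using arc False in_arcsD2 by (auto simp: open_neighborhood_def)
    then have "(y, w) \<in> parcs G"
      using tw by (auto simp: twin_rel_def open_neighborhood_def)
    then have "awalk y ((y, w) # q) z" using q by (simp add: awalk_Cons_iff)
    from gdist_le_awalk[OF assms(1) this] show ?thesis by (simp add: pq)
  qed
qed

lemma resolving_set_twins:
  assumes "pair_graph G" and tw: "(x, y) \<in> twin_rel G" and "x \<noteq> y"
  shows "resolving_set G x y = {x, y}"
proof -
  have wt: "(y, x) \<in> twin_rel G" using tw by (auto simp: twin_rel_def)
  have "gdist G x z = gdist G y z" if "z \<noteq> x" "z \<noteq> y" for z
    using gdist_le_of_twin[OF assms(1) tw that(1)] gdist_le_of_twin[OF assms(1) wt that(2)]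
    by (rule antisym[rotated])
  then have "resolving_set G x y \<subseteq> {x, y}" by (auto simp: resolving_set_def)
  moreover have "{x, y} \<subseteq> resolving_set G x y"
    using tw by (intro resolving_set_contains_ends assms) (auto simp: twin_rel_def)
  ultimately show ?thesis by blast
qed

text \<open>
  At most one point \<open>a\<close> has a value below \<open>1/2\<close>; pairing it with any other point makes up
  for the deficit, and the remaining points contribute at least \<open>1/2\<close> each.
\<close>

lemma sum_excess_nonneg_of_pairs:
  fixes g :: "'a \<Rightarrow> real"
  assumes "card Q \<ge> 2"
    and pair: "\<And>x y. x \<in> Q \<Longrightarrow> y \<in> Q \<Longrightarrow> x \<noteq> y \<Longrightarrow> g x + g y \<ge> 1"
  shows "(\<Sum>x\<in>Q. g x - 1/2) \<ge> 0"
proof (cases "\<forall>x\<in>Q. g x \<ge> 1/2")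
  case True
  then show ?thesis by (intro sum_nonneg) auto
next
  case False
  have fin: "finite Q" using assms(1) by (auto intro: card_ge_0_finite)
  from False obtain a where a: "a \<in> Q" "g a < 1/2" by auto
  have "card (Q - {a}) \<ge> 1" using a assms(1) by simp
  then obtain b where b: "b \<in> Q" "b \<noteq> a" by (metis Diff_iff all_not_in_conv card.empty not_one_le_zero singletonI)
  have "0 \<le> (\<Sum>x\<in>Q - {a} - {b}. g x - 1/2)"
  proof (rule sum_nonneg)
    fix x assume "x \<in> Q - {a} - {b}"
    then show "0 \<le> g x - 1/2" using pair[of a x] a by auto
  qed
  moreover have "(\<Sum>x\<in>Q. g x - 1/2)
      = (g a - 1/2) + ((g b - 1/2) + (\<Sum>x\<in>Q - {a} - {b}. g x - 1/2))"
    using a b fin by (simp add: sum.remove[of Q a] sum.remove[of "Q - {a}" b])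
  ultimately show ?thesis using pair[of a b] a b by auto
qed

lemma sum_excess_nontrivial_twins_nonneg:
  assumes G: "pair_graph G" and g: "resolving_function G g"
  shows "(\<Sum>x\<in>\<Union>(nontrivial_twin_classes G). g x - 1/2) \<ge> 0"
proof -
  have eq: "equiv (pverts G) (twin_rel G)" by (rule equiv_twin_rel[OF G])
  have fin: "finite Q" if "Q \<in> nontrivial_twin_classes G" for Q
    using that by (auto simp: nontrivial_twin_classes_def intro: card_ge_0_finite)
  have "(\<Sum>x\<in>\<Union>(nontrivial_twin_classes G). g x - 1/2)
      = (\<Sum>Q\<in>nontrivial_twin_classes G. \<Sum>x\<in>Q. g x - 1/2)"
  proof (subst sum.Union_disjoint)
    show "\<forall>A\<in>nontrivial_twin_classes G. \<forall>B\<in>nontrivial_twin_classes G. A \<noteq> B \<longrightarrow> A \<inter> B = {}"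
      using quotient_disj[OF eq] by (auto simp: nontrivial_twin_classes_def twin_classes_def)
  qed (use fin in auto)
  also have "\<dots> \<ge> 0"
  proof (rule sum_nonneg, rule sum_excess_nonneg_of_pairs)
    fix Q assume Q: "Q \<in> nontrivial_twin_classes G"
    then show "card Q \<ge> 2" by (simp add: nontrivial_twin_classes_def)
    fix x y assume xy: "x \<in> Q" "y \<in> Q" "x \<noteq> y"
    then have tw: "(x, y) \<in> twin_rel G"
      using Q quotient_eq_iff[OF eq, of Q Q x y]
      by (auto simp: nontrivial_twin_classes_def twin_classes_def)
    then have "x \<in> pverts G" "y \<in> pverts G" by (auto simp: twin_rel_def)
    then have "1 \<le> sum g (resolving_set G x y)"
      using g xy by (auto simp: resolving_function_def)
    then show "1 \<le> g x + g y"
      using resolving_set_twins[OF G tw xy(3)] xy(3) by simp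
  qed
  finally show ?thesis .
qed

text \<open>Double counting: each point of \<open>V\<close> contributes to exactly \<open>c\<close> of the sums over the \<open>T i\<close>.\<close>

lemma sum_nonneg_of_uniform_cover:
  fixes h :: "'a \<Rightarrow> real"
  assumes "finite V" "finite I" "\<And>i. i \<in> I \<Longrightarrow> T i \<subseteq> V"
    and "c > 0" and cover: "\<And>u. u \<in> V \<Longrightarrow> card {i \<in> I. u \<in> T i} = c"
    and nonneg: "\<And>i. i \<in> I \<Longrightarrow> sum h (T i) \<ge> 0"
  shows "sum h V \<ge> 0"
proof -
  have "0 \<le> (\<Sum>i\<in>I. sum h (T i))" using nonneg by (rule sum_nonneg)
  also have "\<dots> = (\<Sum>i\<in>I. \<Sum>u | u \<in> V \<and> u \<in> T i. h u)"
    using assms(3) by (intro sum.cong refl) auto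
  also have "\<dots> = (\<Sum>u\<in>V. \<Sum>i | i \<in> I \<and> u \<in> T i. h u)"
    using assms(1,2) by (intro sum.swap_restrict) auto
  also have "\<dots> = real c * sum h V"
    by (simp add: sum_distrib_left cover)
  finally show ?thesis using \<open>c > 0\<close> by (simp add: zero_le_mult_iff)
qed

lemma resolving_function_half:
  assumes "pair_graph G"
  shows "resolving_function G (\<lambda>_. 1/2)"
proof -
  interpret pair_graph G by fact
  have "1 \<le> (\<Sum>z\<in>resolving_set G x y. 1/2 :: real)"
    if xy: "x \<in> pverts G" "y \<in> pverts G" "x \<noteq> y" for x y
  proof -
    have "finite (resolving_set G x y)" by (simp add: resolving_set_def pair_finite_verts)
    then have "card {x, y} \<le> card (resolving_set G x y)"
      using resolving_set_contains_ends[OF assms xy] by (rule card_mono)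
    then show ?thesis using \<open>x \<noteq> y\<close> by simp
  qed
  then show ?thesis by (auto simp: resolving_function_def)
qed

theorem proposition2p9:
  fixes G :: "nat \<Rightarrow> 'a pair_pre_digraph" and V :: "'a set" and k :: nat
  assumes "k \<ge> 2"
    and "\<And>i. i \<in> {1..k} \<Longrightarrow> pair_graph (G i)"
    and "\<And>i. i \<in> {1..k} \<Longrightarrow> Digraph_Component.connected (with_proj (G i))"
    and "\<And>i. i \<in> {1..k} \<Longrightarrow> pverts (G i) = V"
    and "card V \<ge> 3"
    and "\<exists>c > 0. \<forall>u \<in> V. twin_count k G u = c"
  shows "Sd_f V (G ` {1..k}) = real (card V) / 2"
proof -
  have fin: "finite V" using assms(5) by (auto intro: card_ge_0_finite)
  obtain g where g: "simultaneous_resolving_function V (G ` {1..k}) g"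
    and Sd: "sum g V = Sd_f V (G ` {1..k})"
    and min: "\<And>h. simultaneous_resolving_function V (G ` {1..k}) h \<Longrightarrow> sum g V \<le> sum h V"
    by (rule Sd_f_attained[OF fin, of "G ` {1..k}"]) (use assms(2,4) in auto)
  have "simultaneous_resolving_function V (G ` {1..k}) (\<lambda>_. 1/2)"
    unfolding simultaneous_resolving_function_def
    by (auto intro!: resolving_function_half assms(2))
  from min[OF this] have upper: "sum g V \<le> real (card V) / 2" by simp
  obtain c where c: "c > 0" "\<And>u. u \<in> V \<Longrightarrow> twin_count k G u = c" using assms(6) by auto
  have "0 \<le> (\<Sum>u\<in>V. g u - 1/2)"
  proof (rule sum_nonneg_of_uniform_cover[of V "{1..k}"
        "\<lambda>i. \<Union>(nontrivial_twin_classes (G i))" c])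
    fix i assume i: "i \<in> {1..k}"
    show "\<Union>(nontrivial_twin_classes (G i)) \<subseteq> V"
      using Union_quotient[OF equiv_twin_rel[OF assms(2)[OF i]]] assms(4)[OF i]
      by (auto simp: nontrivial_twin_classes_def twin_classes_def)
    show "0 \<le> (\<Sum>u\<in>\<Union>(nontrivial_twin_classes (G i)). g u - 1/2)"
      using g i by (intro sum_excess_nontrivial_twins_nonneg assms(2))
        (auto simp: simultaneous_resolving_function_def)
  next
    fix u assume "u \<in> V"
    then show "card {i \<in> {1..k}. u \<in> \<Union>(nontrivial_twin_classes (G i))} = c"
      using c(2)[of u] by (simp add: twin_count_def Bex_def conj_commute)
  qed (use fin c in auto)
  then have "real (card V) / 2 \<le> sum g V" by (simp add: sum_subtractf)
  with upper Sd show ?thesis by simp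
qed

end
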